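(* Let $n$ be a positive integer. (a) Let $k$ be an ordered field equipped with the identity conjugation, let $D_i\in k$ be negative for all $i$, put $C_i=-D_i$, and define $k^0=k$ and $k^i=k^{i-1}\times^{D_i}k^{i-1}$ for $i\ge 1$. For $x\in k^n$ with coordinates $x_1,\dots,x_{2^n}\in k$ one has $n(x)=\sum_{i=1}^{2^n}C^{e(i)}x_i^2$, and $$\sum_{i=1}^{2^n}C^{e(i)}x_i^2=1$$ holds if and only if there are $s_j\in k$, $1\le j\le 2^n$, not all zero, such that $$x_1=\frac{s_1^2-\sum_{j=2}^{2^n}C^{e(j)}s_j^2}{\sum_{j=1}^{2^n}C^{e(j)}s_j^2}\quad\text{and}\quad x_i=\frac{2s_1s_i}{\sum_{j=1}^{2^n}C^{e(j)}s_j^2}\ \text{ for } 2\le i\le 2^n.$$ (b) Elements $x_1,\dots,x_{2^n}$ of an ordered field $k$ satisfy $x_1^2+x_2^2+\cdots+x_{2^n}^2=1$ if and only if there are $s_j\in k$, $1\le j\le 2^n$, not all zero, such that $$x_1=\frac{s_1^2-(s_2^2+s_3^2+\cdots+s_{2^n}^2)}{s_1^2+s_2^2+\cdots+s_{2^n}^2}\quad\text{and}\quad x_i=\frac{2s_1s_i}{s_1^2+s_2^2+\cdots+s_{2^n}^2}\ \text{ for } 2\le i\le 2^n.$$ (c) A vector $x=(x_1,\dots,x_{2^n+1})$ of $2^n+1$ integers satisfies $x_1^2+x_2^2+\cdots+x_{2^n}^2=x_{2^n+1}^2$ if and only if $x$ is a rational multiple of a vector of the form $$\big(s_1^2-(s_2^2+s_3^2+\cdots+s_{2^n}^2),\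 2s_1s_2,\ 2s_1s_3,\ \ldots,\ 2s_1s_{2^n},\ s_1^2+s_2^2+\cdots+s_{2^n}^2\big)$$ for some integers $s_1,\dots,s_{2^n}$.
   Context: Let $k$ be a field. A $k$-algebra $K$ (not assumed commutative, associative or distributive) is a left $k$-vector space equipped with a multiplication and a multiplicative identity $1$ such that: $k$ is a subset of the center of $K$, and the additive and multiplicative structure on $k$ is the restriction of that on $K$; and $a(bc)=(ab)c$ for $a,b,c\in K$ whenever at least one of $a,b,c$ belongs to $k$. A conjugation on $K$ is a self-inverse $k$-linear map $\overline{\phantom{a}}:K\to K$ restricting to the identity on $k$. The norm is $n(a)=\overline{a}a$. $K$ is a division algebra over $k$ if for each nonzero $a\in K$ there is a unique $b\in K$ with $ab=ba=1$; then $b$ is written $a^{-1}$. Given a $k$-algebra $K$ with conjugation which is a division algebra, and $D\in k$, the Conway-Smith double $K\times^D K$ is the $k$-vector space $K\times K$ with conjugation $\overline{(a,b)}=(\overline{a},-b)$ and multiplication, for $a,b,c,d\in K$, $$(a,b)(c,d)=\left(ac+D\,\overline{b\,\overline{d}}\,,\ \overline{\overline{b}\;\overline{c}}+\overline{\overline{b}\;\overline{\overline{a}\;\overline{\overline{b^{-1}}\;\overline{d}}}}\right)\quad\text{if } b\ne 0,$$ and $(a,b)(c,d)=(ac,\overline{a}d)$ if $b=0$. It is a $k$-algebra with identity $(1,0)$; $K$ (and hence $k$) is regarded as contained in it via $a\mapsto(a,0)$. In the situation of the claim each $k^i$ is a division algebra with $a^{-1}=\overline{a}\,n(a)^{-1}$,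 so the recursion makes sense. Coordinates on $k^n$ are defined recursively: for $x=(y,z)\in k^n=k^{n-1}\times^{D_n}k^{n-1}$, the coordinates $x_1,\dots,x_{2^{n-1}}$ are the coordinates of $y$ and $x_{2^{n-1}+1},\dots,x_{2^n}$ are the coordinates of $z$ (in order); the only coordinate of an element of $k^0=k$ is the element itself. Order $\{0,1\}^n$ totally by $(a_1,\dots,a_n)<(b_1,\dots,b_n)$ if there is $j$ with $a_j=0$, $b_j=1$ and $a_i=b_i$ for all $i>j$, and let $e(1)<e(2)<\cdots<e(2^n)$ be the elements of $\{0,1\}^n$. Put $C^{e(i)}=\prod_{j=1}^n C_j^{e(i)_j}$, where $e(i)=(e(i)_1,\dots,e(i)_n)$. $k$ is ordered if it carries a total order $\le$ such that $a\le b$ implies $a+c\le b+c$, and $0\le a$, $0\le b$ imply $0\le ab$. An element is negative if it is $\le 0$ and nonzero. (The letter $n$ denotes both the integer and the norm; $n(x)$ is the norm.) *)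

theory Defs
  imports Complex_Main "HOL-Library.FuncSet"
begin

section \<open>Algebras with conjugation\<close>

text \<open>
  The operations of a \<open>k\<close>-algebra \<open>K\<close> with conjugation: no law is built in, and \<open>kincl\<close> is
  the inclusion of \<open>k\<close> into \<open>K\<close>. All operations are meant on \<open>kcarrier\<close> only.
\<close>

record ('k, 'a) conj_algebra =
  kcarrier :: "'a set"
  kincl :: "'k \<Rightarrow> 'a"
  kzero :: 'a
  kone :: 'a
  kadd :: "'a \<Rightarrow> 'a \<Rightarrow> 'a"
  kscale :: "'k \<Rightarrow> 'a \<Rightarrow> 'a"
  kmult :: "'a \<Rightarrow> 'a \<Rightarrow> 'a"
  kconj :: "'a \<Rightarrow> 'a"

definition knorm :: "('k, 'a) conj_algebra \<Rightarrow> 'a \<Rightarrow> 'a" where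
  "knorm K a = kmult K (kconj K a) a"

definition kinv :: "('k, 'a) conj_algebra \<Rightarrow> 'a \<Rightarrow> 'a" where
  "kinv K a = (THE b. b \<in> kcarrier K \<and> kmult K a b = kone K \<and> kmult K b a = kone K)"

section \<open>The Conway-Smith double\<close>

text \<open>
  The type of \<open>k\<^sup>i\<close> would depend on \<open>i\<close>, so the underlying sets of all \<open>k\<^sup>i\<close> live in one type
  of binary trees over \<open>k\<close>, where \<open>Join a b\<close> is the pair \<open>(a, b)\<close>.
\<close>

datatype 'k cs = Scalar 'k | Join "'k cs" "'k cs"

text \<open>The operations below are left unspecified on trees that are not of the shape shown.\<close>

fun scalar_lift1 :: "('k \<Rightarrow> 'k) \<Rightarrow> 'k cs \<Rightarrow> 'k cs" where
  "scalar_lift1 f (Scalar a) = Scalar (f a)"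

fun scalar_lift2 :: "('k \<Rightarrow> 'k \<Rightarrow> 'k) \<Rightarrow> 'k cs \<Rightarrow> 'k cs \<Rightarrow> 'k cs" where
  "scalar_lift2 f (Scalar a) (Scalar b) = Scalar (f a b)"

definition base_algebra :: "('k::field, 'k cs) conj_algebra" where
  "base_algebra =
    \<lparr>kcarrier = range Scalar,
     kincl = Scalar,
     kzero = Scalar 0,
     kone = Scalar 1,
     kadd = scalar_lift2 (+),
     kscale = (\<lambda>c. scalar_lift1 ((*) c)),
     kmult = scalar_lift2 (*),
     kconj = (\<lambda>a. a)\<rparr>"

fun double_add :: "('k, 'k cs) conj_algebra \<Rightarrow> 'k cs \<Rightarrow> 'k cs \<Rightarrow> 'k cs" where
  "double_add K (Join a b) (Join c d) = Join (kadd K a c) (kadd K b d)"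

fun double_scale :: "('k, 'k cs) conj_algebra \<Rightarrow> 'k \<Rightarrow> 'k cs \<Rightarrow> 'k cs" where
  "double_scale K r (Join a b) = Join (kscale K r a) (kscale K r b)"

fun double_conj :: "('k::field, 'k cs) conj_algebra \<Rightarrow> 'k cs \<Rightarrow> 'k cs" where
  "double_conj K (Join a b) = Join (kconj K a) (kscale K (- 1) b)"

fun double_mult :: "'k::field \<Rightarrow> ('k, 'k cs) conj_algebra \<Rightarrow> 'k cs \<Rightarrow> 'k cs \<Rightarrow> 'k cs" where
  "double_mult D K (Join a b) (Join c d) =
    (let m = kmult K; cj = kconj K in
     if b \<noteq> kzero K then
       Join (kadd K (m a c) (kscale K D (cj (m b (cj d)))))
            (kadd K (cj (m (cj b) (cj c)))
                    (cj (m (cj b) (cj (m (cj a) (cj (m (cj (kinv K b)) (cj d))))))))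
     else Join (m a c) (m (cj a) d))"

definition cs_double :: "'k::field \<Rightarrow> ('k, 'k cs) conj_algebra \<Rightarrow> ('k, 'k cs) conj_algebra" where
  "cs_double D K =
    \<lparr>kcarrier = {Join a b | a b. a \<in> kcarrier K \<and> b \<in> kcarrier K},
     kincl = (\<lambda>c. Join (kincl K c) (kzero K)),
     kzero = Join (kzero K) (kzero K),
     kone = Join (kone K) (kzero K),
     kadd = double_add K,
     kscale = double_scale K,
     kmult = double_mult D K,
     kconj = double_conj K\<rparr>"

text \<open>\<open>cs_power D i\<close> is \<open>k\<^sup>i\<close>; it depends only on \<open>D 1, \<dots>, D i\<close>.\<close>

primrec cs_power :: "(nat \<Rightarrow> 'k::field) \<Rightarrow> nat \<Rightarrow> ('k, 'k cs) conj_algebra" where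
  "cs_power D 0 = base_algebra"
| "cs_power D (Suc i) = cs_double (D (Suc i)) (cs_power D i)"

section \<open>Coordinates and multi-indices\<close>

primrec coords :: "'k cs \<Rightarrow> 'k list" where
  "coords (Scalar a) = [a]"
| "coords (Join y z) = coords y @ coords z"

text \<open>Coordinates are numbered from 1.\<close>

definition coord :: "'k cs \<Rightarrow> nat \<Rightarrow> 'k" where
  "coord x i = coords x ! (i - 1)"

definition multi_indices :: "nat \<Rightarrow> (nat \<Rightarrow> nat) set" where
  "multi_indices n = {1..n} \<rightarrow>\<^sub>E {0, 1}"

definition multi_less :: "nat \<Rightarrow> (nat \<Rightarrow> nat) \<Rightarrow> (nat \<Rightarrow> nat) \<Rightarrow> bool" where
  "multi_less n a b \<longleftrightarrow>
    (\<exists>j\<in>{1..n}. a j = 0 \<and> b j = 1 \<and> (\<forall>i\<in>{1..n}. i > j \<longrightarrow> a i = b i))"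

text \<open>
  \<open>multi_enum n\<close> is the increasing enumeration \<open>e(1) < \<dots> < e(2\<^sup>n)\<close> of \<open>{0,1}\<^sup>n\<close>; requiring it
  to be extensional makes it unique as a total function.
\<close>

definition multi_enum :: "nat \<Rightarrow> nat \<Rightarrow> (nat \<Rightarrow> nat)" where
  "multi_enum n =
    (THE e. e \<in> extensional {1..2 ^ n} \<and> bij_betw e {1..2 ^ n} (multi_indices n) \<and>
       (\<forall>i\<in>{1..2 ^ n}. \<forall>j\<in>{1..2 ^ n}. i < j \<longrightarrow> multi_less n (e i) (e j)))"

definition multi_power :: "nat \<Rightarrow> (nat \<Rightarrow> 'k::field) \<Rightarrow> (nat \<Rightarrow> nat) \<Rightarrow> 'k" where
  "multi_power n C e = (\<Prod>j=1..n. C j ^ e j)"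

end

theory Submission
  imports Defs
begin

text \<open>
  Although the double is neither distributive on the right nor associative, each left
  multiplication \<open>L\<^sub>x\<close> on \<open>k\<^sup>n\<close> is linear, its adjoint with respect to the weighted scalar product
  is the left multiplication by the conjugate of \<open>x\<close>, and it scales the quadratic form \<open>N\<close> by
  \<open>N x\<close>. These properties pass to the double. They give that the product of the conjugate of
  \<open>x\<close> with \<open>x\<close> is \<open>N x\<close>, and that inverses exist and are unique, since \<open>N\<close> is anisotropic and so
  \<open>L\<^sub>x\<close> is injective. The parametrization is the stereographic projection from \<open>(-1, 0, \<dots>, 0)\<close>: the
  point \<open>x\<close> comes from \<open>s = 1 + x\<close>, and the centre itself from any \<open>s \<noteq> 0\<close> with \<open>s\<^sub>1 = 0\<close>.
\<close>

section \<open>Algebras with adjoint left multiplication\<close>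

text \<open>\<open>B\<close> is the symmetric form with \<open>B x x\<close> the norm of
  \<open>x\<close>. The product is additive in its right factor only, since additivity in the left
  factor does not survive doubling. All laws are relative to the carrier because the operations on
  trees are unspecified elsewhere.\<close>

locale adjoint_conj_algebra =
  fixes K :: "('k::linordered_field, 'a) conj_algebra" and B :: "'a \<Rightarrow> 'a \<Rightarrow> 'k"
  assumes zero_closed [simp]: "kzero K \<in> kcarrier K"
    and one_closed [simp]: "kone K \<in> kcarrier K"
    and add_closed [simp]: "\<lbrakk>x \<in> kcarrier K; y \<in> kcarrier K\<rbrakk> \<Longrightarrow> kadd K x y \<in> kcarrier K"
    and scale_closed [simp]: "x \<in> kcarrier K \<Longrightarrow> kscale K c x \<in> kcarrier K"
    and conj_closed [simp]: "x \<in> kcarrier K \<Longrightarrow> kconj K x \<in> kcarrier K"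
    and mult_closed [simp]: "\<lbrakk>x \<in> kcarrier K; y \<in> kcarrier K\<rbrakk> \<Longrightarrow> kmult K x y \<in> kcarrier K"
    and add_assoc: "\<lbrakk>x \<in> kcarrier K; y \<in> kcarrier K; z \<in> kcarrier K\<rbrakk> \<Longrightarrow>
      kadd K (kadd K x y) z = kadd K x (kadd K y z)"
    and add_comm: "\<lbrakk>x \<in> kcarrier K; y \<in> kcarrier K\<rbrakk> \<Longrightarrow> kadd K x y = kadd K y x"
    and add_zero [simp]: "x \<in> kcarrier K \<Longrightarrow> kadd K x (kzero K) = x"
    and scale_one [simp]: "x \<in> kcarrier K \<Longrightarrow> kscale K 1 x = x"
    and scale_zero [simp]: "x \<in> kcarrier K \<Longrightarrow> kscale K 0 x = kzero K"
    and scale_scale [simp]: "x \<in> kcarrier K \<Longrightarrow> kscale K c (kscale K d x) = kscale K (c * d) x"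
    and scale_add_left: "x \<in> kcarrier K \<Longrightarrow> kscale K (c + d) x = kadd K (kscale K c x) (kscale K d x)"
    and scale_add_right: "\<lbrakk>x \<in> kcarrier K; y \<in> kcarrier K\<rbrakk> \<Longrightarrow>
      kscale K c (kadd K x y) = kadd K (kscale K c x) (kscale K c y)"
    and conj_conj [simp]: "x \<in> kcarrier K \<Longrightarrow> kconj K (kconj K x) = x"
    and conj_one [simp]: "kconj K (kone K) = kone K"
    and conj_add: "\<lbrakk>x \<in> kcarrier K; y \<in> kcarrier K\<rbrakk> \<Longrightarrow>
      kconj K (kadd K x y) = kadd K (kconj K x) (kconj K y)"
    and conj_scale [simp]: "x \<in> kcarrier K \<Longrightarrow> kconj K (kscale K c x) = kscale K c (kconj K x)"
    and incl_eq: "kincl K c = kscale K c (kone K)"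
    and one_mult [simp]: "x \<in> kcarrier K \<Longrightarrow> kmult K (kone K) x = x"
    and mult_one [simp]: "x \<in> kcarrier K \<Longrightarrow> kmult K x (kone K) = x"
    and mult_add: "\<lbrakk>x \<in> kcarrier K; y \<in> kcarrier K; z \<in> kcarrier K\<rbrakk> \<Longrightarrow>
      kmult K x (kadd K y z) = kadd K (kmult K x y) (kmult K x z)"
    and mult_scale_right [simp]: "\<lbrakk>x \<in> kcarrier K; y \<in> kcarrier K\<rbrakk> \<Longrightarrow>
      kmult K x (kscale K c y) = kscale K c (kmult K x y)"
    and mult_scale_left [simp]: "\<lbrakk>x \<in> kcarrier K; y \<in> kcarrier K\<rbrakk> \<Longrightarrow>
      kmult K (kscale K c x) y = kscale K c (kmult K x y)"
    and form_sym: "\<lbrakk>x \<in> kcarrier K; y \<in> kcarrier K\<rbrakk> \<Longrightarrow> B x y = B y x"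
    and form_add_left: "\<lbrakk>x \<in> kcarrier K; y \<in> kcarrier K; z \<in> kcarrier K\<rbrakk> \<Longrightarrow>
      B (kadd K x y) z = B x z + B y z"
    and form_scale_left [simp]: "\<lbrakk>x \<in> kcarrier K; y \<in> kcarrier K\<rbrakk> \<Longrightarrow> B (kscale K c x) y = c * B x y"
    and form_conj: "\<lbrakk>x \<in> kcarrier K; y \<in> kcarrier K\<rbrakk> \<Longrightarrow> B (kconj K x) (kconj K y) = B x y"
    and form_adjoint: "\<lbrakk>x \<in> kcarrier K; y \<in> kcarrier K; z \<in> kcarrier K\<rbrakk> \<Longrightarrow>
      B (kmult K x y) z = B y (kmult K (kconj K x) z)"
    and form_mult: "\<lbrakk>x \<in> kcarrier K; y \<in> kcarrier K\<rbrakk> \<Longrightarrow>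
      B (kmult K x y) (kmult K x y) = B x x * B y y"
    and form_pos: "\<lbrakk>x \<in> kcarrier K; x \<noteq> kzero K\<rbrakk> \<Longrightarrow> 0 < B x x"
begin

section \<open>Linear algebra of the operations and the form\<close>

lemma form_add_right: "\<lbrakk>x \<in> kcarrier K; y \<in> kcarrier K; z \<in> kcarrier K\<rbrakk> \<Longrightarrow>
    B z (kadd K x y) = B z x + B z y"
  by (metis form_add_left form_sym add_closed)

lemma form_scale_right [simp]: "\<lbrakk>x \<in> kcarrier K; y \<in> kcarrier K\<rbrakk> \<Longrightarrow> B x (kscale K c y) = c * B x y"
  by (metis form_scale_left form_sym scale_closed)

lemma scale_of_zero [simp]: "kscale K c (kzero K) = kzero K"
  by (metis mult_zero_right scale_scale scale_zero zero_closed)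

lemma zero_add [simp]: "x \<in> kcarrier K \<Longrightarrow> kadd K (kzero K) x = x"
  by (metis add_comm add_zero zero_closed)

lemma conj_zero [simp]: "kconj K (kzero K) = kzero K"
  by (metis conj_scale conj_closed scale_zero zero_closed)

lemma mult_zero [simp]: "x \<in> kcarrier K \<Longrightarrow> kmult K x (kzero K) = kzero K"
  by (metis mult_scale_right mult_closed scale_zero zero_closed)

lemma zero_mult [simp]: "x \<in> kcarrier K \<Longrightarrow> kmult K (kzero K) x = kzero K"
  by (metis mult_scale_left mult_closed scale_zero zero_closed)

lemma form_zero_left [simp]: "x \<in> kcarrier K \<Longrightarrow> B (kzero K) x = 0"
  by (metis form_scale_left mult_zero_left scale_zero zero_closed)

lemma form_zero_right [simp]: "x \<in> kcarrier K \<Longrightarrow> B x (kzero K) = 0"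
  by (metis form_zero_left form_sym zero_closed)

lemma form_eq_0_iff: "x \<in> kcarrier K \<Longrightarrow> B x x = 0 \<longleftrightarrow> x = kzero K"
  using form_pos by fastforce

lemma add_neg [simp]: "x \<in> kcarrier K \<Longrightarrow> kadd K x (kscale K (- 1) x) = kzero K"
  using scale_add_left[of x 1 "- 1"] by simp

lemma neg_add [simp]: "x \<in> kcarrier K \<Longrightarrow> kadd K (kscale K (- 1) x) x = kzero K"
  using scale_add_left[of x "- 1" 1] by simp

lemma eq_if_diff_zero:
  assumes "x \<in> kcarrier K" "y \<in> kcarrier K" "kadd K x (kscale K (- 1) y) = kzero K"
  shows "x = y"
proof -
  have "x = kadd K x (kadd K (kscale K (- 1) y) y)"
    using assms by simp
  also have "\<dots> = y"
    using assms by (simp add: add_assoc[symmetric] del: neg_add)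
  finally show ?thesis .
qed

lemma scale_eq_zero: "\<lbrakk>x \<in> kcarrier K; kscale K c x = kzero K; c \<noteq> 0\<rbrakk> \<Longrightarrow> x = kzero K"
  by (metis scale_scale scale_one scale_of_zero left_inverse)

section \<open>Norm, left cancellation and inverses from adjointness\<close>

text \<open>Definiteness at the difference of \<open>x\<close> and \<open>y\<close> suffices.
  Identities between values of \<open>B\<close> thereby become identities in \<open>K\<close>, which
  stands in for associativity.\<close>

lemma form_nondegenerate:
  assumes "x \<in> kcarrier K" "y \<in> kcarrier K" "\<And>z. z \<in> kcarrier K \<Longrightarrow> B x z = B y z"
  shows "x = y"
proof (rule eq_if_diff_zero)
  let ?d = "kadd K x (kscale K (- 1) y)"
  have "B ?d ?d = 0"
    using assms by (simp add: form_add_left)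
  then show "?d = kzero K"
    using assms by (simp add: form_eq_0_iff)
qed (use assms in auto)

text \<open>Polarization of \<open>form_mult\<close> at the sum of \<open>y\<close> and
  \<open>z\<close>; the factor 2 of the mixed terms cancels in an ordered field.\<close>

lemma form_mult_left:
  assumes "x \<in> kcarrier K" "y \<in> kcarrier K" "z \<in> kcarrier K"
  shows "B (kmult K x y) (kmult K x z) = B x x * B y z"
proof -
  have "B (kmult K x (kadd K y z)) (kmult K x (kadd K y z)) = B x x * B (kadd K y z) (kadd K y z)"
    using assms by (intro form_mult) auto
  then show ?thesis
    using assms form_sym[of y z] form_sym[of "kmult K x y" "kmult K x z"]
    by (simp add: mult_add form_add_left form_add_right form_mult algebra_simps)
qed

text \<open>A weak substitute for associativity. Tested against \<open>z\<close>, the outer factor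
  passes to the other side as \<open>x\<close> itself, and \<open>form_mult_left\<close>
  applies.\<close>

lemma conj_mult_mult:
  assumes "x \<in> kcarrier K" "y \<in> kcarrier K"
  shows "kmult K (kconj K x) (kmult K x y) = kscale K (B x x) y"
proof (rule form_nondegenerate)
  fix z assume "z \<in> kcarrier K"
  then show "B (kmult K (kconj K x) (kmult K x y)) z = B (kscale K (B x x) y) z"
    using assms by (simp add: form_adjoint[of "kconj K x"] form_mult_left)
qed (use assms in auto)

lemma conj_mult_self: "x \<in> kcarrier K \<Longrightarrow> kmult K (kconj K x) x = kscale K (B x x) (kone K)"
  using conj_mult_mult[of x "kone K"] by simp

lemma mult_conj_self: "x \<in> kcarrier K \<Longrightarrow> kmult K x (kconj K x) = kscale K (B x x) (kone K)"
  using conj_mult_self[of "kconj K x"] by (simp add: form_conj)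

lemma norm_eq: "x \<in> kcarrier K \<Longrightarrow> knorm K x = kincl K (B x x)"
  by (simp add: knorm_def incl_eq conj_mult_self)

text \<open>Multiplication by the conjugate of \<open>x\<close> turns the vanishing product of
  \<open>x\<close> with the difference into the vanishing of \<open>B x x\<close> times the
  difference.\<close>

lemma mult_left_cancel:
  assumes "x \<in> kcarrier K" "x \<noteq> kzero K" "y \<in> kcarrier K" "z \<in> kcarrier K"
    and "kmult K x y = kmult K x z"
  shows "y = z"
proof (rule eq_if_diff_zero)
  let ?d = "kadd K y (kscale K (- 1) z)"
  have "kmult K x ?d = kzero K"
    using assms by (simp add: mult_add)
  then have "kscale K (B x x) ?d = kzero K"
    using conj_mult_mult[of x ?d] assms by simp
  then show "?d = kzero K"
    using assms form_pos[of x] scale_eq_zero[of ?d "B x x"] by simp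
qed (use assms in auto)

text \<open>The two products of \<open>x\<close> with its conjugate give a two-sided inverse; left
  cancellation makes it unique, so the description in \<open>kinv\<close> denotes it.\<close>

lemma inv_eq:
  assumes "x \<in> kcarrier K" "x \<noteq> kzero K"
  shows "kinv K x = kscale K (1 / B x x) (kconj K x)"
  unfolding kinv_def
proof (rule the_equality)
  have "B x x \<noteq> 0"
    using assms form_pos by fastforce
  then show *: "kscale K (1 / B x x) (kconj K x) \<in> kcarrier K \<and>
      kmult K x (kscale K (1 / B x x) (kconj K x)) = kone K \<and>
      kmult K (kscale K (1 / B x x) (kconj K x)) x = kone K"
    using assms by (simp add: mult_conj_self conj_mult_self)
  show "y = kscale K (1 / B x x) (kconj K x)"
    if "y \<in> kcarrier K \<and> kmult K x y = kone K \<and> kmult K y x = kone K" for y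
    using that * assms mult_left_cancel by metis
qed

end

section \<open>The double\<close>

text \<open>For positive definite \<open>B\<close> and \<open>D < 0\<close> this is the orthogonal
  sum of \<open>B\<close> and its positive multiple by \<open>- D\<close>.\<close>

fun double_form :: "'k::field \<Rightarrow> ('k cs \<Rightarrow> 'k cs \<Rightarrow> 'k) \<Rightarrow> 'k cs \<Rightarrow> 'k cs \<Rightarrow> 'k" where
  "double_form D B (Join a b) (Join c d) = B a c - D * B b d"

text \<open>Eliminates \<open>kinv\<close>: the conjugate of the inverse of \<open>b\<close> is
  \<open>b\<close> divided by \<open>B b b\<close>. Additivity in the right factor then collects the
  second component into one product with left factor \<open>kconj K b\<close>, to which
  \<open>form_mult\<close> applies.\<close>

lemma double_mult_eq:
  fixes K :: "('k::linordered_field, 'k cs) conj_algebra"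
  assumes "adjoint_conj_algebra K B"
    and [simp]: "a \<in> kcarrier K" "b \<in> kcarrier K" "c \<in> kcarrier K" "d \<in> kcarrier K"
  shows "double_mult D K (Join a b) (Join c d) =
    (if b = kzero K then Join (kmult K a c) (kmult K (kconj K a) d)
     else Join
       (kadd K (kmult K a c) (kscale K D (kconj K (kmult K b (kconj K d)))))
       (kconj K (kmult K (kconj K b) (kadd K (kconj K c)
         (kscale K (1 / B b b)
           (kconj K (kmult K (kconj K a) (kconj K (kmult K b (kconj K d))))))))))"
proof -
  interpret adjoint_conj_algebra K B by fact
  show ?thesis
    by (auto simp: Let_def inv_eq mult_add conj_add)
qed

declare double_mult.simps [simp del]

lemma base_adjoint_conj_algebra:
  "adjoint_conj_algebra (base_algebra :: ('k::linordered_field, 'k cs) conj_algebra)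
    (\<lambda>x y. coord x 1 * coord y 1)"
  by unfold_locales
    (auto simp: base_algebra_def coord_def algebra_simps zero_less_mult_iff)

text \<open>The inductive step along \<open>cs_power\<close>. Negativity of \<open>D\<close> enters
  through definiteness of the form, which supplies the inverses for the next doubling.\<close>

lemma double_adjoint_conj_algebra:
  fixes K :: "('k::linordered_field, 'k cs) conj_algebra"
  assumes K: "adjoint_conj_algebra K B" and D: "D < 0"
  shows "adjoint_conj_algebra (cs_double D K) (double_form D B)"
proof -
  interpret adjoint_conj_algebra K B by (fact K)
  note mult_eq = double_mult_eq[OF K]
  have sel: "kcarrier (cs_double D K) = {Join a b | a b. a \<in> kcarrier K \<and> b \<in> kcarrier K}"
    "kincl (cs_double D K) = (\<lambda>c. Join (kincl K c) (kzero K))"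
    "kzero (cs_double D K) = Join (kzero K) (kzero K)"
    "kone (cs_double D K) = Join (kone K) (kzero K)"
    "kadd (cs_double D K) = double_add K"
    "kscale (cs_double D K) = double_scale K"
    "kmult (cs_double D K) = double_mult D K"
    "kconj (cs_double D K) = double_conj K"
    by (simp_all add: cs_double_def)
  have add_swap: "kadd K (kadd K p q) (kadd K r s) = kadd K (kadd K p r) (kadd K q s)"
    if "p \<in> kcarrier K" "q \<in> kcarrier K" "r \<in> kcarrier K" "s \<in> kcarrier K" for p q r s
    using that by (metis add_assoc add_comm add_closed)
  have mult_closed': "double_mult D K x y \<in> kcarrier (cs_double D K)"
    if "x \<in> kcarrier (cs_double D K)" "y \<in> kcarrier (cs_double D K)" for x y
    using that by (auto simp: sel mult_eq)
  have mult_add': "double_mult D K x (double_add K y z) =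
      double_add K (double_mult D K x y) (double_mult D K x z)"
    if "x \<in> kcarrier (cs_double D K)" "y \<in> kcarrier (cs_double D K)" "z \<in> kcarrier (cs_double D K)"
    for x y z
    using that by (auto simp: sel mult_eq mult_add conj_add scale_add_right add_swap)
  have mult_scale_right': "double_mult D K x (double_scale K c y) = double_scale K c (double_mult D K x y)"
    if "x \<in> kcarrier (cs_double D K)" "y \<in> kcarrier (cs_double D K)" for x y c
    using that by (auto simp: sel mult_eq mult_add conj_add scale_add_right mult_ac)
  have mult_scale_left': "double_mult D K (double_scale K c x) y = double_scale K c (double_mult D K x y)"
    if "x \<in> kcarrier (cs_double D K)" "y \<in> kcarrier (cs_double D K)" for x y c
  \<comment> \<open>For \<open>c = 0\<close> the scaled second component vanishes and the other
    branch of the product is taken. Otherwise the branch stays the same, and the three factors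
    \<open>c\<close> from \<open>a\<close>, \<open>b\<close>, \<open>b\<close> meet
    \<open>c ^ 2\<close> in the denominator.\<close>
  proof (cases "c = 0")
    case True
    with that show ?thesis by (auto simp: sel mult_eq)
  next
    case False
    with that show ?thesis
      by (auto simp: sel mult_eq mult_add conj_add scale_add_right mult_ac dest: scale_eq_zero)
  qed
  have form_adjoint': "double_form D B (double_mult D K x y) z =
      double_form D B y (double_mult D K (double_conj K x) z)"
    if xyz: "x \<in> kcarrier (cs_double D K)" "y \<in> kcarrier (cs_double D K)" "z \<in> kcarrier (cs_double D K)"
    for x y z
  proof -
    obtain a b c d e f where eqs: "x = Join a b" "y = Join c d" "z = Join e f"
      and [simp]: "a \<in> kcarrier K" "b \<in> kcarrier K" "c \<in> kcarrier K" "d \<in> kcarrier K"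
        "e \<in> kcarrier K" "f \<in> kcarrier K"
      using xyz by (auto simp: sel)
    show ?thesis
    proof (cases "b = kzero K")
      case True
      then show ?thesis by (simp add: eqs mult_eq form_adjoint)
    next
      case False
      \<comment> \<open>Conjugation in the double negates \<open>b\<close>, so the product on the
        right side of the claim is also in the branch with inverse.\<close>
      have neg: "kscale K (- 1) b \<noteq> kzero K"
        using False scale_eq_zero[of b "- 1"] by auto
      \<comment> \<open>Conjugation is self-adjoint; together with \<open>form_adjoint\<close> this
        moves every factor to the right argument of \<open>B\<close>.\<close>
      have shift: "B (kconj K p) q = B p (kconj K q)"
        if "p \<in> kcarrier K" "q \<in> kcarrier K" for p q
        using that form_conj[of p "kconj K q"] by simp
      show ?thesis
        using False neg
        by (simp add: eqs mult_eq mult_add conj_add form_add_left form_add_right shift form_adjoint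
            field_simps)
    qed
  qed
  have form_sym': "double_form D B x y = double_form D B y x"
    if "x \<in> kcarrier (cs_double D K)" "y \<in> kcarrier (cs_double D K)" for x y
    using that by (auto simp: sel intro!: arg_cong2[where f = minus] arg_cong[where f = "(*) D"] form_sym)
  have form_mult': "double_form D B (double_mult D K x y) (double_mult D K x y) =
      double_form D B x x * double_form D B y y"
    if xy: "x \<in> kcarrier (cs_double D K)" "y \<in> kcarrier (cs_double D K)" for x y
  proof -
    obtain a b c d where eqs: "x = Join a b" "y = Join c d"
      and [simp]: "a \<in> kcarrier K" "b \<in> kcarrier K" "c \<in> kcarrier K" "d \<in> kcarrier K"
      using xy by (auto simp: sel)
    show ?thesis
    proof (cases "b = kzero K")
      case True
      then show ?thesis by (simp add: eqs mult_eq form_mult form_conj algebra_simps)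
    next
      case False
      then have nb: "B b b \<noteq> 0"
        by (simp add: form_eq_0_iff)
      \<comment> \<open>The element shared by both components of the product; \<open>b\<close> and
        \<open>d\<close> enter the first component only through it.\<close>
      define w where "w = kconj K (kmult K b (kconj K d))"
      have [simp]: "w \<in> kcarrier K" by (simp add: w_def)
      have w: "B w w = B b b * B d d"
        by (simp add: w_def form_conj form_mult)
      have cross: "B (kmult K a c) w = B c (kmult K (kconj K a) w)"
        by (simp add: form_adjoint)
      have "B (kadd K (kmult K a c) (kscale K D w)) (kadd K (kmult K a c) (kscale K D w)) =
          B a a * B c c + 2 * D * B c (kmult K (kconj K a) w) + D * D * (B b b * B d d)"
        using form_sym[of w "kmult K a c"]
        by (simp add: form_add_left form_add_right form_mult w cross algebra_simps)
      moreover have "B b b * B (kadd K (kconj K c) (kscale K (1 / B b b) (kconj K (kmult K (kconj K a) w))))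
          (kadd K (kconj K c) (kscale K (1 / B b b) (kconj K (kmult K (kconj K a) w)))) =
          B b b * B c c + 2 * B c (kmult K (kconj K a) w) + B a a * B d d"
        using nb form_sym[of "kmult K (kconj K a) w" c]
        by (simp add: form_add_left form_add_right form_mult form_conj w field_simps)
      \<comment> \<open>The second component is weighted by \<open>- D\<close>, so the mixed terms
        \<open>2 * D * B c (kmult K (kconj K a) w)\<close> cancel and the rest factors as the
        product of the two norms.\<close>
      ultimately show ?thesis
        using False
        by (simp add: eqs mult_eq w_def[symmetric] form_conj form_mult algebra_simps)
    qed
  qed
  have form_pos': "0 < double_form D B x x"
    if x: "x \<in> kcarrier (cs_double D K)" "x \<noteq> Join (kzero K) (kzero K)" for x
  proof -
    obtain a b where eqs: "x = Join a b"
      and [simp]: "a \<in> kcarrier K" "b \<in> kcarrier K"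
      using x by (auto simp: sel)
    have "0 \<le> B a a" "0 \<le> B b b"
      using form_pos[of a] form_pos[of b] by fastforce+
    moreover have "0 < B a a \<or> 0 < B b b"
      using x form_pos[of a] form_pos[of b] by (auto simp: eqs)
    moreover have "D * B b b \<le> 0" "0 < B b b \<Longrightarrow> D * B b b < 0"
      using D calculation(2) by (auto simp: mult_le_0_iff mult_less_0_iff)
    ultimately show ?thesis
      by (auto simp: eqs)
  qed
  show ?thesis
    by unfold_locales
      (use mult_closed' mult_add' mult_scale_right' mult_scale_left' form_adjoint' form_sym' form_mult' form_pos'
        in \<open>auto simp: sel add_assoc scale_add_left scale_add_right conj_add incl_eq mult_eq
          form_add_left form_conj algebra_simps intro: add_comm\<close>)
qed

section \<open>The enumeration of multi-indices\<close>

text \<open>\<open>multi_less\<close> lets the highest differing index decide, so it is the order of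
  binary numbers whose digit of weight \<open>2 ^ (j - 1)\<close> is \<open>a j\<close>.\<close>

definition binary_value :: "nat \<Rightarrow> (nat \<Rightarrow> nat) \<Rightarrow> nat" where
  "binary_value n a = (\<Sum>j=1..n. a j * 2 ^ (j - 1))"

text \<open>Restricted to \<open>{1..n}\<close> because members of \<open>multi_indices n\<close>
  are extensional.\<close>

definition binary_digits :: "nat \<Rightarrow> nat \<Rightarrow> nat \<Rightarrow> nat" where
  "binary_digits n m = (\<lambda>j\<in>{1..n}. m div 2 ^ (j - 1) mod 2)"

lemma binary_value_Suc: "binary_value (Suc n) a = binary_value n a + a (Suc n) * 2 ^ n"
  by (simp add: binary_value_def)

lemma binary_value_less:
  assumes "\<And>j. j \<in> {1..n} \<Longrightarrow> a j \<in> {0, 1}"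
  shows "binary_value n a < 2 ^ n"
  using assms
proof (induction n)
  case 0
  show ?case by (simp add: binary_value_def)
next
  case (Suc n)
  then have "binary_value n a < 2 ^ n" "a (Suc n) \<in> {0, 1}" by auto
  then show ?case by (auto simp: binary_value_Suc)
qed

lemma digit_of_binary_value:
  assumes "\<And>j. j \<in> {1..n} \<Longrightarrow> a j \<in> {0, 1}" "j \<in> {1..n}"
  shows "binary_value n a div 2 ^ (j - 1) mod 2 = a j"
  using assms
proof (induction n)
  case 0
  then show ?case by simp
next
  case (Suc n)
  have less: "binary_value n a < 2 ^ n"
    using Suc.prems by (intro binary_value_less) auto
  show ?case
  proof (cases "j = Suc n")
    case True
    then show ?thesis using less Suc.prems(1)[of j] by (auto simp: binary_value_Suc)
  next
    case False
    then have j: "j \<in> {1..n}" using Suc.prems(2) by auto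
    \<comment> \<open>After division by \<open>2 ^ (j - 1)\<close> the new top digit contributes an
      even number, which does not affect the lower digit \<open>j\<close>.\<close>
    then have "(2::nat) ^ n = 2 ^ (n - j) * 2 * 2 ^ (j - 1)"
      by (simp flip: power_add power_Suc2 power_Suc)
    then have "binary_value (Suc n) a div 2 ^ (j - 1) =
        (binary_value n a + a (Suc n) * 2 ^ (n - j) * 2 * 2 ^ (j - 1)) div 2 ^ (j - 1)"
      by (simp add: binary_value_Suc mult.assoc)
    also have "\<dots> = a (Suc n) * 2 ^ (n - j) * 2 + binary_value n a div 2 ^ (j - 1)"
      by (subst div_mult_self1) auto
    finally show ?thesis using Suc.IH[OF _ j] Suc.prems(1) by simp
  qed
qed

lemma multi_indices_bit: "\<lbrakk>a \<in> multi_indices n; j \<in> {1..n}\<rbrakk> \<Longrightarrow> a j \<in> {0, 1}"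
  unfolding multi_indices_def by (rule PiE_mem)

lemma binary_value_less_indices: "a \<in> multi_indices n \<Longrightarrow> binary_value n a < 2 ^ n"
  by (rule binary_value_less, rule multi_indices_bit)

lemma binary_digits_value:
  assumes a: "a \<in> multi_indices n"
  shows "binary_digits n (binary_value n a) = a"
proof
  fix j
  show "binary_digits n (binary_value n a) j = a j"
  proof (cases "j \<in> {1..n}")
    case True
    have "binary_value n a div 2 ^ (j - 1) mod 2 = a j"
      using multi_indices_bit[OF a] True by (rule digit_of_binary_value)
    then show ?thesis
      using True by (simp add: binary_digits_def)
  next
    case False
    then show ?thesis
      using PiE_arb[of a "{1..n}" "\<lambda>_. {0, 1}" j] a
      by (simp add: binary_digits_def multi_indices_def del: atLeastAtMost_iff)
  qed
qed

text \<open>Stated for every \<open>m\<close>: higher digits are cut off, so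
  \<open>2 ^ n + m\<close> and \<open>m\<close> have the same \<open>n\<close> digits.\<close>

lemma binary_value_digits: "binary_value n (binary_digits n m) = m mod 2 ^ n"
proof (induction n)
  case 0
  show ?case by (simp add: binary_value_def)
next
  case (Suc n)
  have "binary_value n (binary_digits (Suc n) m) = binary_value n (binary_digits n m)"
    by (auto simp: binary_value_def binary_digits_def intro!: sum.cong)
  then have "binary_value (Suc n) (binary_digits (Suc n) m) = m mod 2 ^ n + m div 2 ^ n mod 2 * 2 ^ n"
    using Suc by (simp add: binary_value_Suc) (simp add: binary_digits_def)
  also have "\<dots> = m mod 2 ^ Suc n"
    using mod_mult2_eq[of m "2 ^ n" 2] by (simp add: mult.commute)
  finally show ?case .
qed

lemma binary_digits_mem: "binary_digits n m \<in> multi_indices n"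
  by (auto simp: binary_digits_def multi_indices_def)

section \<open>The order of multi-indices and its unique enumeration\<close>

lemma multi_less_Suc:
  "multi_less (Suc n) a b \<longleftrightarrow>
    a (Suc n) = 0 \<and> b (Suc n) = 1 \<or> a (Suc n) = b (Suc n) \<and> multi_less n a b"
proof -
  have "{1..Suc n} = insert (Suc n) {1..n}" by auto
  then show ?thesis unfolding multi_less_def by auto
qed

text \<open>The top digit outweighs all lower digits together, whose value stays below its
  weight.\<close>

lemma multi_less_iff_value:
  assumes "\<And>j. j \<in> {1..n} \<Longrightarrow> a j \<in> {0, 1} \<and> b j \<in> {0, 1}"
  shows "multi_less n a b \<longleftrightarrow> binary_value n a < binary_value n b"
  using assms
proof (induction n)
  case 0
  show ?case by (simp add: binary_value_def multi_less_def)
next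
  case (Suc n)
  have bits: "a j \<in> {0, 1}" "b j \<in> {0, 1}" if "j \<in> {1..Suc n}" for j
    using Suc.prems that by blast+
  have "binary_value n a < 2 ^ n" "binary_value n b < 2 ^ n"
    by (rule binary_value_less, rule bits, simp)+
  moreover have "a (Suc n) \<in> {0, 1}" "b (Suc n) \<in> {0, 1}"
    by (rule bits, simp)+
  moreover have "multi_less n a b \<longleftrightarrow> binary_value n a < binary_value n b"
    by (rule Suc.IH) (use Suc.prems in auto)
  ultimately show ?case
    unfolding multi_less_Suc binary_value_Suc by auto
qed

lemma multi_less_iff:
  assumes "a \<in> multi_indices n" "b \<in> multi_indices n"
  shows "multi_less n a b \<longleftrightarrow> binary_value n a < binary_value n b"
proof (rule multi_less_iff_value)
  show "a j \<in> {0, 1} \<and> b j \<in> {0, 1}" if "j \<in> {1..n}" for j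
    using assms[THEN multi_indices_bit, OF that] by blast
qed

text \<open>Each step raises \<open>f\<close> by at least 1: climbing from 0 to \<open>i\<close>
  bounds \<open>f i\<close> from below, climbing from \<open>i\<close> to \<open>N - 1\<close>
  bounds it from above.\<close>

lemma strict_mono_below_eq_id:
  fixes f :: "nat \<Rightarrow> nat"
  assumes mono: "\<And>i j. \<lbrakk>i < j; j < N\<rbrakk> \<Longrightarrow> f i < f j" and bound: "\<And>i. i < N \<Longrightarrow> f i < N" and "i < N"
  shows "f i = i"
proof (rule antisym)
  have shift: "f i + d \<le> f (i + d)" if "i + d < N" for i d
    using that
  proof (induction d)
    case (Suc d)
    then show ?case using mono[of "i + d" "i + Suc d"] by simp
  qed simp
  show "i \<le> f i"
    using shift[of 0 i] \<open>i < N\<close> by simp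
  show "f i \<le> i"
    using shift[of i "N - 1 - i"] bound[of "N - 1"] \<open>i < N\<close> by simp
qed

text \<open>Evaluates the description in \<open>multi_enum\<close>. Positions start at 1 and binary
  values at 0, hence \<open>i - 1\<close>.\<close>

lemma multi_enum_eq:
  assumes "i \<in> {1..2 ^ n}"
  shows "multi_enum n i = binary_digits n (i - 1)"
proof -
  let ?e = "\<lambda>i\<in>{1..2 ^ n}. binary_digits n (i - 1)"
  have value_digits: "binary_value n (binary_digits n (i - 1)) = i - 1" if "i \<in> {1..2 ^ n}" for i
    using that by (subst binary_value_digits) (auto intro: mod_less)
  have "multi_enum n = ?e"
    unfolding multi_enum_def
  proof (rule the_equality)
    have "bij_betw (\<lambda>i. binary_digits n (i - 1)) {1..2 ^ n} (multi_indices n)"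
    proof (rule bij_betwI[where g = "\<lambda>a. Suc (binary_value n a)"])
      show "(\<lambda>a. Suc (binary_value n a)) \<in> multi_indices n \<rightarrow> {1..2 ^ n}"
        by (simp add: Suc_le_eq Pi_iff binary_value_less_indices)
    next
      show "Suc (binary_value n (binary_digits n (i - 1))) = i" if "i \<in> {1..2 ^ n}" for i
        using that value_digits[OF that] by simp
    qed (auto simp: binary_digits_mem binary_digits_value)
    then have "bij_betw ?e {1..2 ^ n} (multi_indices n)"
      by (rule iffD1[OF bij_betw_cong, rotated]) simp
    moreover have "multi_less n (?e i) (?e j)"
      if "i \<in> {1..2 ^ n}" "j \<in> {1..2 ^ n}" "i < j" for i j
      using that value_digits[OF that(1)] value_digits[OF that(2)]
      by (auto simp: multi_less_iff binary_digits_mem)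
    ultimately show "?e \<in> extensional {1..2 ^ n} \<and> bij_betw ?e {1..2 ^ n} (multi_indices n) \<and>
        (\<forall>i\<in>{1..2 ^ n}. \<forall>j\<in>{1..2 ^ n}. i < j \<longrightarrow> multi_less n (?e i) (?e j))"
      by blast
  next
    fix e :: "nat \<Rightarrow> nat \<Rightarrow> nat"
    assume e: "e \<in> extensional {1..2 ^ n} \<and> bij_betw e {1..2 ^ n} (multi_indices n) \<and>
        (\<forall>i\<in>{1..2 ^ n}. \<forall>j\<in>{1..2 ^ n}. i < j \<longrightarrow> multi_less n (e i) (e j))"
    then have mem: "e i \<in> multi_indices n" if "i \<in> {1..2 ^ n}" for i
      using that bij_betwE by blast
    have increasing: "multi_less n (e i) (e j)" if "i \<in> {1..2 ^ n}" "j \<in> {1..2 ^ n}" "i < j" for i j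
      using e that by blast
    \<comment> \<open>Uniqueness: composed with \<open>binary_value\<close>, a competing enumeration
      is a strictly increasing self-map of the numbers below \<open>2 ^ n\<close>.\<close>
    have "binary_value n (e (Suc m)) = m" if "m < 2 ^ n" for m
    proof (rule strict_mono_below_eq_id[where f = "\<lambda>m. binary_value n (e (Suc m))"])
      show "binary_value n (e (Suc i)) < binary_value n (e (Suc j))" if "i < j" "j < 2 ^ n" for i j
        using that multi_less_iff[OF mem mem] increasing by simp
      show "binary_value n (e (Suc i)) < 2 ^ n" if "i < 2 ^ n" for i
        using that binary_value_less_indices[OF mem] by simp
    qed fact
    then have "e i = binary_digits n (i - 1)" if "i \<in> {1..2 ^ n}" for i
      using that binary_digits_value[OF mem[OF that]] by (cases i) simp_all
    then show "e = ?e"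
      using conjunct1[OF e] by (intro ext) (auto simp: restrict_def extensional_def)
  qed
  then show ?thesis using assms by simp
qed

section \<open>The weights along the enumeration\<close>

text \<open>The lower half of the enumeration has top digit 0 and the upper half top digit 1,
  matching the two components of a pair.\<close>

lemma multi_power_digits_Suc:
  assumes "m < 2 ^ n"
  shows "multi_power (Suc n) C (binary_digits (Suc n) m) = multi_power n C (binary_digits n m)"
    and "multi_power (Suc n) C (binary_digits (Suc n) (2 ^ n + m)) =
      C (Suc n) * multi_power n C (binary_digits n m)"
proof -
  have split: "multi_power (Suc n) C (binary_digits (Suc n) l) =
      C (Suc n) ^ (l div 2 ^ n mod 2) * multi_power n C (binary_digits n l)" for l
    by (simp add: multi_power_def binary_digits_def)
  have "binary_digits n (2 ^ n + m) = binary_digits n m"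
    using binary_digits_value[OF binary_digits_mem, of n "2 ^ n + m"]
      binary_digits_value[OF binary_digits_mem, of n m]
    by (simp add: binary_value_digits)
  then show "multi_power (Suc n) C (binary_digits (Suc n) (2 ^ n + m)) =
      C (Suc n) * multi_power n C (binary_digits n m)"
    using assms by (simp add: split)
  show "multi_power (Suc n) C (binary_digits (Suc n) m) = multi_power n C (binary_digits n m)"
    using assms by (simp add: split)
qed

lemma multi_power_enum_one: "multi_power n C (multi_enum n 1) = 1"
  by (auto simp: multi_enum_eq multi_power_def binary_digits_def intro!: prod.neutral)

lemma multi_power_pos:
  fixes C :: "nat \<Rightarrow> 'k::linordered_field"
  shows "(\<And>j. j \<in> {1..n} \<Longrightarrow> 0 < C j) \<Longrightarrow> 0 < multi_power n C e"
  by (auto simp: multi_power_def intro!: prod_pos)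

section \<open>The norm in coordinates\<close>

fun cs_form :: "(nat \<Rightarrow> 'k::field) \<Rightarrow> nat \<Rightarrow> 'k cs \<Rightarrow> 'k cs \<Rightarrow> 'k" where
  "cs_form D 0 = (\<lambda>x y. coord x 1 * coord y 1)"
| "cs_form D (Suc n) = double_form (D (Suc n)) (cs_form D n)"

lemma cs_power_adjoint_conj_algebra:
  fixes D :: "nat \<Rightarrow> 'k::linordered_field"
  shows "(\<And>i. i \<in> {1..n} \<Longrightarrow> D i < 0) \<Longrightarrow> adjoint_conj_algebra (cs_power D n) (cs_form D n)"
  by (induction n) (simp_all add: base_adjoint_conj_algebra double_adjoint_conj_algebra del: One_nat_def)

lemma length_coords: "x \<in> kcarrier (cs_power D n) \<Longrightarrow> length (coords x) = 2 ^ n"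
  by (induction n arbitrary: x) (auto simp: base_algebra_def cs_double_def)

lemma sum_doubled:
  fixes f :: "nat \<Rightarrow> 'b::comm_monoid_add"
  shows "(\<Sum>m<2 ^ Suc n. f m) = (\<Sum>m<2 ^ n. f m) + (\<Sum>m<2 ^ n. f (2 ^ n + m))"
  using sum.atLeastLessThan_concat[of 0 "2 ^ n" "2 ^ n + 2 ^ n" f]
    sum.shift_bounds_nat_ivl[of f 0 "2 ^ n" "2 ^ n"]
  by (simp add: lessThan_atLeast0 add.commute mult_2)

lemma cs_form_coords:
  assumes "x \<in> kcarrier (cs_power D n)" "\<And>i. i \<in> {1..n} \<Longrightarrow> C i = - D i"
  shows "cs_form D n x x =
    (\<Sum>m<2 ^ n. multi_power n C (binary_digits n m) * (coords x ! m) ^ 2)"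
  using assms
proof (induction n arbitrary: x)
  case 0
  then show ?case
    by (auto simp: base_algebra_def coord_def multi_power_def power2_eq_square)
next
  case (Suc n)
  then obtain a b where x: "x = Join a b"
    and ab: "a \<in> kcarrier (cs_power D n)" "b \<in> kcarrier (cs_power D n)"
    by (auto simp: cs_double_def)
  have len: "length (coords a) = 2 ^ n"
    using ab(1) by (rule length_coords)
  have "cs_form D (Suc n) x x = cs_form D n a a + C (Suc n) * cs_form D n b b"
    using Suc.prems(2)[of "Suc n"] by (simp add: x)
  also have "cs_form D n a a =
      (\<Sum>m<2 ^ n. multi_power (Suc n) C (binary_digits (Suc n) m) * (coords x ! m) ^ 2)"
    using Suc.IH[OF ab(1)] Suc.prems(2) len
    by (simp add: multi_power_digits_Suc x nth_append)
  also have "C (Suc n) * cs_form D n b b = (\<Sum>m<2 ^ n.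
      multi_power (Suc n) C (binary_digits (Suc n) (2 ^ n + m)) * (coords x ! (2 ^ n + m)) ^ 2)"
    using Suc.IH[OF ab(2)] Suc.prems(2) len
    by (simp add: multi_power_digits_Suc x nth_append sum_distrib_left mult.assoc)
  finally show ?case
    by (simp only: sum_doubled)
qed

lemma cs_form_coord:
  assumes "x \<in> kcarrier (cs_power D n)" "\<And>i. i \<in> {1..n} \<Longrightarrow> C i = - D i"
  shows "cs_form D n x x = (\<Sum>i=1..2^n. multi_power n C (multi_enum n i) * coord x i ^ 2)"
proof -
  have "(\<Sum>i=1..2^n. multi_power n C (multi_enum n i) * coord x i ^ 2) =
      (\<Sum>i=1..2^n. multi_power n C (binary_digits n (i - 1)) * coord x i ^ 2)"
    by (intro sum.cong) (simp_all add: multi_enum_eq)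
  also have "\<dots> = (\<Sum>m<2 ^ n. multi_power n C (binary_digits n m) * (coords x ! m) ^ 2)"
    by (rule sum.reindex_bij_witness[of _ Suc "\<lambda>i. i - 1"]) (auto simp: coord_def)
  finally show ?thesis
    using cs_form_coords[OF assms] by simp
qed

section \<open>Stereographic projection\<close>

text \<open>Arbitrary positive weights cover both the norm form and the plain sum of
  squares.\<close>

lemma sphere_parametrization:
  fixes w x :: "nat \<Rightarrow> 'k::linordered_field"
  assumes N: "2 \<le> N" and w1: "w 1 = 1" and wpos: "\<And>i. i \<in> {2..N} \<Longrightarrow> 0 < w i"
  shows "(\<Sum>i=1..N. w i * x i ^ 2) = 1 \<longleftrightarrow>
    (\<exists>s. (\<exists>j\<in>{1..N}. s j \<noteq> 0) \<and>
      x 1 = (s 1 ^ 2 - (\<Sum>j=2..N. w j * s j ^ 2)) / (\<Sum>j=1..N. w j * s j ^ 2) \<and>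
      (\<forall>i\<in>{2..N}. x i = 2 * s 1 * s i / (\<Sum>j=1..N. w j * s j ^ 2)))"
proof -
  define T where "T = (\<lambda>s. \<Sum>j=2..N. w j * s j ^ 2)"
  have T_fold: "(\<Sum>j=2..N. w j * s j ^ 2) = T s" for s
    by (simp add: T_def)
  have total: "(\<Sum>j=1..N. w j * s j ^ 2) = s 1 ^ 2 + T s" for s
    using N sum.atLeast_Suc_atMost[of 1 N "\<lambda>j. w j * s j ^ 2"]
    by (simp add: T_def w1[simplified] numeral_2_eq_2)
  have nonneg: "0 \<le> w i * s i ^ 2" if "i \<in> {2..N}" for i and s :: "nat \<Rightarrow> 'k"
    using wpos[OF that] by simp
  have T_zero: "s i = 0" if "T s = 0" "i \<in> {2..N}" for s i
  proof -
    have "\<forall>j\<in>{2..N}. w j * s j ^ 2 = 0"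
      using that(1) unfolding T_def by (subst (asm) sum_nonneg_eq_0_iff) (simp_all add: nonneg)
    then have "w i * s i ^ 2 = 0"
      using that(2) by (rule bspec)
    then show ?thesis using wpos[OF that(2)] by simp
  qed
  have "x 1 ^ 2 + T x = 1 \<longleftrightarrow> (\<exists>s. (\<exists>j\<in>{1..N}. s j \<noteq> 0) \<and>
      x 1 = (s 1 ^ 2 - T s) / (s 1 ^ 2 + T s) \<and> (\<forall>i\<in>{2..N}. x i = 2 * s 1 * s i / (s 1 ^ 2 + T s)))"
    (is "_ \<longleftrightarrow> (\<exists>s. ?P s)")
  proof
    assume x: "x 1 ^ 2 + T x = 1"
    show "\<exists>s. ?P s"
    proof (cases "x 1 = - 1")
      case True
      then have x0: "x i = 0" if "i \<in> {2..N}" for i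
        using x T_zero[OF _ that] by simp
      \<comment> \<open>Here \<open>x\<close> is the centre. The second unit vector exists since
        \<open>2 \<le> N\<close>, and it gives first coordinate \<open>- w 2 / w 2\<close>.\<close>
      define s where "s = (\<lambda>i::nat. if i = 2 then 1 else 0 :: 'k)"
      have "T s = w 2"
        using N by (simp add: T_def s_def if_distrib[where f = "\<lambda>a. _ * a ^ 2"] sum.delta cong: if_cong)
      then have "?P s"
        using N True x0 wpos[of 2] by (auto simp: s_def)
      then show ?thesis by blast
    next
      case False
      then have ne: "1 + x 1 \<noteq> 0"
        by (simp add: add_eq_0_iff)
      \<comment> \<open>With this choice the denominator is \<open>2 * (1 + x 1)\<close>, and
        division by it returns each \<open>x i\<close>.\<close>
      define s where "s = x(1 := 1 + x 1)"
      have "T s = T x"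
        by (auto simp: T_def s_def intro!: sum.cong)
      moreover have "T x = 1 - x 1 ^ 2"
        using x by (simp add: algebra_simps)
      ultimately have Q: "s 1 ^ 2 + T s = 2 * (1 + x 1)" "s 1 ^ 2 - T s = 2 * (1 + x 1) * x 1"
        by (simp_all add: s_def power2_eq_square algebra_simps)
      have "?P s"
        unfolding Q using N ne by (auto simp: s_def intro!: bexI[of _ 1])
      then show ?thesis by blast
    qed
  next
    assume "\<exists>s. ?P s"
    then obtain s where nz: "\<exists>j\<in>{1..N}. s j \<noteq> 0" and s: "?P s" by blast
    have "0 \<le> T s"
      unfolding T_def by (intro sum_nonneg nonneg)
    \<comment> \<open>With positive weights the denominator vanishes only if every
      \<open>s j\<close> does.\<close>
    moreover have "s 1 ^ 2 + T s \<noteq> 0"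
    proof
      assume "s 1 ^ 2 + T s = 0"
      with \<open>0 \<le> T s\<close> have "s 1 = 0" "T s = 0"
        by (simp_all add: add_nonneg_eq_0_iff)
      with T_zero[OF \<open>T s = 0\<close>] nz show False
        by (metis One_nat_def Suc_leI atLeastAtMost_iff le_neq_implies_less numeral_2_eq_2)
    qed
    ultimately have Q: "s 1 ^ 2 + T s \<noteq> 0" by simp
    have "T x = (\<Sum>j=2..N. (2 * s 1 / (s 1 ^ 2 + T s)) ^ 2 * (w j * s j ^ 2))"
      unfolding T_fold[of x, symmetric] using s
      by (intro sum.cong) (auto simp: power_mult_distrib power_divide)
    also have "\<dots> = (2 * s 1 / (s 1 ^ 2 + T s)) ^ 2 * T s"
      by (simp only: T_def sum_distrib_left)
    finally have Tx: "T x = (2 * s 1 / (s 1 ^ 2 + T s)) ^ 2 * T s" .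
    \<comment> \<open>The identity behind the parametrization: the projected point lies on the
      sphere.\<close>
    have "(s 1 ^ 2 - T s) ^ 2 + (2 * s 1) ^ 2 * T s = (s 1 ^ 2 + T s) ^ 2"
      by (simp add: power2_eq_square algebra_simps)
    then show "x 1 ^ 2 + T x = 1"
      using Q s unfolding Tx
      by (simp add: power_divide add_divide_distrib[symmetric])
  qed
  then show ?thesis
    by (simp only: total T_fold)
qed

section \<open>Integer points on the cone\<close>

text \<open>The homogeneous version of the projection: the rational factor \<open>q\<close> takes
  the place of the denominator, so the parameters can be integers.\<close>

lemma integer_cone_parametrization:
  fixes x :: "nat \<Rightarrow> int"
  assumes N: "2 \<le> N"
  shows "(\<Sum>i=1..N. x i ^ 2) = z ^ 2 \<longleftrightarrow>
    (\<exists>(s :: nat \<Rightarrow> int) (q :: rat).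
      of_int (x 1) = q * of_int (s 1 ^ 2 - (\<Sum>j=2..N. s j ^ 2)) \<and>
      (\<forall>i\<in>{2..N}. of_int (x i) = q * of_int (2 * s 1 * s i)) \<and>
      of_int z = q * of_int (\<Sum>j=1..N. s j ^ 2))"
proof -
  define T where "T = (\<lambda>s. \<Sum>j=2..N. s j ^ 2 :: int)"
  have T_fold: "(\<Sum>j=2..N. s j ^ 2) = T s" for s
    by (simp add: T_def)
  have total: "(\<Sum>j=1..N. s j ^ 2) = s 1 ^ 2 + T s" for s
    using N sum.atLeast_Suc_atMost[of 1 N "\<lambda>j. s j ^ 2"]
    by (simp add: T_def numeral_2_eq_2)
  have "x 1 ^ 2 + T x = z ^ 2 \<longleftrightarrow> (\<exists>(s :: nat \<Rightarrow> int) (q :: rat).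
      of_int (x 1) = q * of_int (s 1 ^ 2 - T s) \<and>
      (\<forall>i\<in>{2..N}. of_int (x i) = q * of_int (2 * s 1 * s i)) \<and>
      of_int z = q * of_int (s 1 ^ 2 + T s))"
    (is "_ \<longleftrightarrow> (\<exists>s q. ?P s q)")
  proof
    assume x: "x 1 ^ 2 + T x = z ^ 2"
    show "\<exists>s q. ?P s q"
    proof (cases "x 1 + z = 0")
      case True
      then have z: "z = - x 1" by simp
      then have "T x = 0" using x by simp
      then have x0: "x i = 0" if "i \<in> {2..N}" for i
        using that by (auto simp: T_def sum_nonneg_eq_0_iff)
      \<comment> \<open>The ray through the centre: this \<open>s\<close> yields first entry -1,
        last entry 1 and zeros between, and the factor is \<open>z\<close>. The zero vector falls
        here, with \<open>q = 0\<close>.\<close>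
      define s where "s = (\<lambda>i::nat. if i = 2 then 1 else 0 :: int)"
      have "T s = 1"
        using N by (simp add: T_def s_def if_distrib[where f = "\<lambda>a. a ^ 2"] sum.delta cong: if_cong)
      then have "?P s (of_int z)"
        using x0 z by (simp add: s_def)
      then show ?thesis by blast
    next
      case False
      \<comment> \<open>The homogeneous form of \<open>1 + x 1\<close>. The resulting vector is
        \<open>2 * d\<close> times the given one, hence the factor
        \<open>1 / (2 * d)\<close>.\<close>
      define d where "d = x 1 + z"
      define s where "s = x(1 := d)"
      have "T s = T x"
        by (auto simp: T_def s_def intro!: sum.cong)
      moreover have "T x = z ^ 2 - x 1 ^ 2"
        using x by (simp add: algebra_simps)
      ultimately have Q: "s 1 ^ 2 + T s = 2 * d * z" "s 1 ^ 2 - T s = 2 * d * x 1"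
        by (simp_all add: s_def d_def power2_eq_square algebra_simps)
      have ne: "(of_int d :: rat) \<noteq> 0"
        using False by (simp add: d_def)
      have "?P s (1 / (2 * of_int d))"
        unfolding Q using ne by (auto simp: s_def)
      then show ?thesis by blast
    qed
  next
    assume "\<exists>s q. ?P s q"
    then obtain s q where s: "?P s q" by blast
    have "(of_int (T x) :: rat) = (\<Sum>j=2..N. (2 * q * of_int (s 1)) ^ 2 * of_int (s j ^ 2))"
      unfolding T_def of_int_sum using s
      by (intro sum.cong) (auto simp: power_mult_distrib)
    also have "\<dots> = (2 * q * of_int (s 1)) ^ 2 * of_int (T s)"
      by (simp only: T_def sum_distrib_left of_int_sum)
    finally have Tx: "(of_int (T x) :: rat) = (2 * q * of_int (s 1)) ^ 2 * of_int (T s)" .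
    have x1: "of_int (x 1) = q * of_int (s 1 ^ 2 - T s)"
      using s by blast
    have "(of_int (x 1 ^ 2 + T x) :: rat) = of_int (x 1) ^ 2 + of_int (T x)"
      by simp
    also have "\<dots> = (q * of_int (s 1 ^ 2 + T s)) ^ 2"
      unfolding Tx x1 by (simp add: power2_eq_square algebra_simps)
    also have "\<dots> = of_int (z ^ 2)"
      using s by (metis of_int_power)
    finally show "x 1 ^ 2 + T x = z ^ 2"
      by (simp only: of_int_eq_iff)
  qed
  then show ?thesis
    by (simp only: total T_fold)
qed

section \<open>Assembly of the three claims\<close>

theorem mainTheorem5:
  fixes n :: nat
  assumes "n > 0"
  shows
    "(\<forall>(D :: nat \<Rightarrow> 'k::linordered_field) C.
        (\<forall>i\<in>{1..n}. D i < 0) \<and> (\<forall>i\<in>{1..n}. C i = - D i) \<longrightarrow>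
        (\<forall>x \<in> kcarrier (cs_power D n).
          knorm (cs_power D n) x =
            kincl (cs_power D n) (\<Sum>i=1..2^n. multi_power n C (multi_enum n i) * coord x i ^ 2) \<and>
          ((\<Sum>i=1..2^n. multi_power n C (multi_enum n i) * coord x i ^ 2) = 1 \<longleftrightarrow>
           (\<exists>s :: nat \<Rightarrow> 'k.
              (\<exists>j\<in>{1..2^n}. s j \<noteq> 0) \<and>
              coord x 1 =
                (s 1 ^ 2 - (\<Sum>j=2..2^n. multi_power n C (multi_enum n j) * s j ^ 2)) /
                (\<Sum>j=1..2^n. multi_power n C (multi_enum n j) * s j ^ 2) \<and>
              (\<forall>i\<in>{2..2^n}. coord x i =
                 2 * s 1 * s i / (\<Sum>j=1..2^n. multi_power n C (multi_enum n j) * s j ^ 2))))))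
     \<and>
     (\<forall>x :: nat \<Rightarrow> 'k.
        (\<Sum>i=1..2^n. x i ^ 2) = 1 \<longleftrightarrow>
        (\<exists>s :: nat \<Rightarrow> 'k.
           (\<exists>j\<in>{1..2^n}. s j \<noteq> 0) \<and>
           x 1 = (s 1 ^ 2 - (\<Sum>j=2..2^n. s j ^ 2)) / (\<Sum>j=1..2^n. s j ^ 2) \<and>
           (\<forall>i\<in>{2..2^n}. x i = 2 * s 1 * s i / (\<Sum>j=1..2^n. s j ^ 2))))
     \<and>
     (\<forall>x :: nat \<Rightarrow> int.
        (\<Sum>i=1..2^n. x i ^ 2) = x (2^n + 1) ^ 2 \<longleftrightarrow>
        (\<exists>(s :: nat \<Rightarrow> int) (q :: rat).
           of_int (x 1) = q * of_int (s 1 ^ 2 - (\<Sum>j=2..2^n. s j ^ 2)) \<and>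
           (\<forall>i\<in>{2..2^n}. of_int (x i) = q * of_int (2 * s 1 * s i)) \<and>
           of_int (x (2^n + 1)) = q * of_int (\<Sum>j=1..2^n. s j ^ 2)))"
(is "?A \<and> (\<forall>x. ?B x) \<and> (\<forall>x. ?C x)")
proof -
  have N: "(2::nat) \<le> 2 ^ n"
    using assms self_le_power[of 2 n] by simp
  have a: "knorm (cs_power D n) x =
        kincl (cs_power D n) (\<Sum>i=1..2^n. multi_power n C (multi_enum n i) * coord x i ^ 2) \<and>
      ((\<Sum>i=1..2^n. multi_power n C (multi_enum n i) * coord x i ^ 2) = 1 \<longleftrightarrow>
       (\<exists>s :: nat \<Rightarrow> 'k.
          (\<exists>j\<in>{1..2^n}. s j \<noteq> 0) \<and>
          coord x 1 =
            (s 1 ^ 2 - (\<Sum>j=2..2^n. multi_power n C (multi_enum n j) * s j ^ 2)) /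
            (\<Sum>j=1..2^n. multi_power n C (multi_enum n j) * s j ^ 2) \<and>
          (\<forall>i\<in>{2..2^n}. coord x i =
             2 * s 1 * s i / (\<Sum>j=1..2^n. multi_power n C (multi_enum n j) * s j ^ 2))))"
    if D: "\<forall>i\<in>{1..n}. D i < 0" and C: "\<forall>i\<in>{1..n}. C i = - D i"
      and x: "x \<in> kcarrier (cs_power D n)"
    for D C :: "nat \<Rightarrow> 'k" and x
  proof
    interpret adjoint_conj_algebra "cs_power D n" "cs_form D n"
      using D by (intro cs_power_adjoint_conj_algebra) blast
    show "knorm (cs_power D n) x =
        kincl (cs_power D n) (\<Sum>i=1..2^n. multi_power n C (multi_enum n i) * coord x i ^ 2)"
      using norm_eq[OF x] cs_form_coord[OF x, of C] C by metis
  \<comment> \<open>The first multi-index is zero, so the weight of the first coordinate is 1; the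
    other weights are positive because each \<open>C i = - D i\<close> is.\<close>
  qed (rule sphere_parametrization, use N C D in \<open>auto intro!: multi_power_enum_one multi_power_pos simp del: One_nat_def\<close>)
  then have conic: "?A" by blast
  show ?thesis
  proof (intro conjI conic allI)
    show "?B x" for x
      using sphere_parametrization[where w = "\<lambda>_. 1 :: 'k" and x = x, OF N] by simp
    show "?C x" for x
      by (rule integer_cone_parametrization[OF N])
  qed
qed

end
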